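(* Let $G$ be a connected simple graph with vertex set $\mathbb{N}$ and uniformly bounded degree. If $G$ is a regular or a biregular graph, then $\mathcal{A}_{RW}(G)\cong \mathcal{A}(G)$ (isomorphic as Hilbert evolution algebras). Moreover, if $G$ is non-singular and $\mathcal{A}_{RW}(G)\cong \mathcal{A}(G)$, then $G$ is a regular or a biregular graph.
   Context: Graph notation: graphs are simple (no loops or multiple edges), with vertex set $\mathbb{N}$; $(a_{ij})$ is the adjacency matrix ($a_{ij}=1$ if $i,j$ are adjacent, $0$ otherwise), and $\deg(i)=\sum_k a_{ki}$. $G$ has uniformly bounded degree if there is $M>0$ with $\deg(i)\le M$ for all $i$. $G$ is regular if all vertices have the same degree; $G$ is biregular (more precisely $(d_1,d_2)$-biregular) if it is bipartite with parts $V_1,V_2$ such that every vertex of $V_1$ has degree $d_1$ and every vertex of $V_2$ has degree $d_2$. Adjacency operator: for $G$ of uniformly bounded degree, $A:\ell^2(\mathbb{N})\to\ell^2(\mathbb{N})$ is the bounded operator $A(v)=\sum_{k}\big(\sum_{i} v_i a_{ki}\big)\delta_k$, where $v=\sum_i v_i\delta_i$ and $\{\delta_i\}$ is the standard orthonormal basis. $G$ is non-singular if $\ker A=\{0\}$. Hilbert evolution algebra: a real or complex separable Hilbert space $\mathcal{A}$ with an algebra product $\cdot$ such that (i) there are an orthonormal basis $\{e_i\}_{i\in\mathbb{N}}$ and scalars $c_{ki}$ with $e_i\cdot e_i=\sum_{k=1}^\infty c_{ki}e_k$ and $e_i\cdot e_j=0$ for $i\ne j$ (so $v\cdot w=\sum_k(\sum_i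 v_iw_ic_{ki})e_k$ for $v=\sum v_ie_i$, $w=\sum w_ie_i$), and (ii) for each $v\in\mathcal{A}$ the left multiplication $L_v(w)=v\cdot w$ is continuous. Fix a separable Hilbert space $\mathcal{A}$ with orthonormal basis $\{e_i\}_{i\in\mathbb{N}}$. $\mathcal{A}(G)$ is the Hilbert evolution algebra on $\mathcal{A}$ with $c_{ki}=a_{ki}$, i.e. $e_i\cdot e_i=\sum_k a_{ki}e_k$, $e_i\cdot e_j=0$ for $i\neq j$. $\mathcal{A}_{RW}(G)$ is the Hilbert evolution algebra on $\mathcal{A}$ with $c_{ki}=a_{ki}/\deg(i)$, i.e. $e_i\cdot e_i=\sum_k \frac{a_{ki}}{\deg(i)}e_k$, $e_i\cdot e_j=0$ for $i\neq j$. A homomorphism of Hilbert evolution algebras is a continuous linear map that is an algebra homomorphism; it is an isomorphism of Hilbert evolution algebras if moreover its inverse exists and is continuous. $\mathcal{A}\cong\mathcal{A}'$ means that such an isomorphism exists. *)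

theory Defs
  imports "HOL-Analysis.Analysis"
begin

section \<open>Real and complex scalars\<close>

text \<open>
  A common class for the two scalar fields. By the Gelfand--Mazur theorem a normed field over the
  reals is the reals or the complex numbers, and \<open>mult_rconj\<close> then forces \<open>rconj\<close> to be the usual
  conjugation.
\<close>

class rc_field = real_normed_field + banach +
  fixes rconj :: "'a \<Rightarrow> 'a"
  assumes rconj_add: "rconj (x + y) = rconj x + rconj y"
    and rconj_mult: "rconj (x * y) = rconj x * rconj y"
    and rconj_rconj: "rconj (rconj x) = x"
    and mult_rconj: "x * rconj x = (norm x)\<^sup>2 *\<^sub>R 1"

instantiation real :: rc_field
begin
definition rconj_real :: "real \<Rightarrow> real" where "rconj_real x = x"
instance by standard (simp_all add: rconj_real_def power2_eq_square)
end

instantiation complex :: rc_field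
begin
definition rconj_complex :: "complex \<Rightarrow> complex" where "rconj_complex = cnj"
instance
proof
  fix x :: complex
  show "x * rconj x = (norm x)\<^sup>2 *\<^sub>R 1"
    unfolding rconj_complex_def scaleR_conv_of_real using complex_norm_square[of x] by simp
qed (simp_all add: rconj_complex_def)
end


section \<open>Hilbert spaces over these scalars\<close>

text \<open>
  Completeness, the norm and the topology come from the class \<open>banach\<close>. Separability is not assumed
  separately, since it follows from the existence of an orthonormal basis indexed by \<open>nat\<close>.
\<close>

locale hilbert_space = vector_space scl
  for scl :: "'k::rc_field \<Rightarrow> 'a::banach \<Rightarrow> 'a"
    and ip :: "'a \<Rightarrow> 'a \<Rightarrow> 'k" +
  assumes scale_of_real: "scl (of_real r) x = r *\<^sub>R x"
    and ip_add_left: "ip (x + y) z = ip x z + ip y z"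
    and ip_scale_left: "ip (scl a x) y = a * ip x y"
    and ip_commute: "ip y x = rconj (ip x y)"
    and ip_self: "ip x x = of_real ((norm x)\<^sup>2)"

definition orthonormal_basis ::
    "('k::rc_field \<Rightarrow> 'a::banach \<Rightarrow> 'a) \<Rightarrow> ('a \<Rightarrow> 'a \<Rightarrow> 'k) \<Rightarrow> (nat \<Rightarrow> 'a) \<Rightarrow> bool" where
  "orthonormal_basis scl ip e \<longleftrightarrow>
     (\<forall>i j. ip (e i) (e j) = (if i = j then 1 else 0)) \<and>
     closure (module.span scl (range e)) = UNIV"


section \<open>Hilbert evolution algebras\<close>

text \<open>Structure constants are indexed as \<open>c k i\<close>: the coefficient of \<open>e k\<close> in \<open>e i \<cdot> e i\<close>.\<close>

definition evolution_basis ::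
    "('k::rc_field \<Rightarrow> 'a::banach \<Rightarrow> 'a) \<Rightarrow> ('a \<Rightarrow> 'a \<Rightarrow> 'k) \<Rightarrow> ('a \<Rightarrow> 'a \<Rightarrow> 'a) \<Rightarrow>
     (nat \<Rightarrow> 'a) \<Rightarrow> (nat \<Rightarrow> nat \<Rightarrow> 'k) \<Rightarrow> bool" where
  "evolution_basis scl ip mul e c \<longleftrightarrow>
     orthonormal_basis scl ip e \<and>
     (\<forall>i. (\<lambda>k. scl (c k i) (e k)) sums mul (e i) (e i)) \<and>
     (\<forall>i j. i \<noteq> j \<longrightarrow> mul (e i) (e j) = 0) \<and>
     (\<forall>v w. (\<forall>k. summable (\<lambda>i. ip v (e i) * ip w (e i) * c k i)) \<and>
            (\<lambda>k. scl (\<Sum>i. ip v (e i) * ip w (e i) * c k i) (e k)) sums mul v w)"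

locale hilbert_evolution_algebra = hilbert_space scl ip
  for scl :: "'k::rc_field \<Rightarrow> 'a::banach \<Rightarrow> 'a"
    and ip :: "'a \<Rightarrow> 'a \<Rightarrow> 'k" +
  fixes mul :: "'a \<Rightarrow> 'a \<Rightarrow> 'a"
  assumes linear_mul_left: "Vector_Spaces.linear scl scl (\<lambda>v. mul v w)"
    and linear_mul_right: "Vector_Spaces.linear scl scl (mul v)"
    and ex_evolution_basis: "\<exists>e c. evolution_basis scl ip mul e c"
    and continuous_mul: "continuous_on UNIV (mul v)"

definition hea_hom ::
    "('k::rc_field \<Rightarrow> 'a::banach \<Rightarrow> 'a) \<Rightarrow> ('a \<Rightarrow> 'a \<Rightarrow> 'a) \<Rightarrow>
     ('k \<Rightarrow> 'b::banach \<Rightarrow> 'b) \<Rightarrow> ('b \<Rightarrow> 'b \<Rightarrow> 'b) \<Rightarrow> ('a \<Rightarrow> 'b) \<Rightarrow> bool" where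
  "hea_hom scl mul scl' mul' f \<longleftrightarrow>
     Vector_Spaces.linear scl scl' f \<and> continuous_on UNIV f \<and>
     (\<forall>v w. f (mul v w) = mul' (f v) (f w))"

definition hea_isomorphic ::
    "('k::rc_field \<Rightarrow> 'a::banach \<Rightarrow> 'a) \<Rightarrow> ('a \<Rightarrow> 'a \<Rightarrow> 'k) \<Rightarrow> ('a \<Rightarrow> 'a \<Rightarrow> 'a) \<Rightarrow>
     ('k \<Rightarrow> 'b::banach \<Rightarrow> 'b) \<Rightarrow> ('b \<Rightarrow> 'b \<Rightarrow> 'k) \<Rightarrow> ('b \<Rightarrow> 'b \<Rightarrow> 'b) \<Rightarrow> bool" where
  "hea_isomorphic scl ip mul scl' ip' mul' \<longleftrightarrow>
     hilbert_evolution_algebra scl ip mul \<and> hilbert_evolution_algebra scl' ip' mul' \<and>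
     (\<exists>f. hea_hom scl mul scl' mul' f \<and> bij f \<and> continuous_on UNIV (inv f))"

definition evolution_product ::
    "('k::rc_field \<Rightarrow> 'a::banach \<Rightarrow> 'a) \<Rightarrow> ('a \<Rightarrow> 'a \<Rightarrow> 'k) \<Rightarrow> (nat \<Rightarrow> 'a) \<Rightarrow>
     (nat \<Rightarrow> nat \<Rightarrow> 'k) \<Rightarrow> 'a \<Rightarrow> 'a \<Rightarrow> 'a" where
  "evolution_product scl ip e c v w =
     (\<Sum>k. scl (\<Sum>i. ip v (e i) * ip w (e i) * c k i) (e k))"


section \<open>Graphs on the natural numbers\<close>

definition simple_graph :: "(nat \<Rightarrow> nat \<Rightarrow> bool) \<Rightarrow> bool" where
  "simple_graph E \<longleftrightarrow> symp E \<and> irreflp E"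

definition connected_graph :: "(nat \<Rightarrow> nat \<Rightarrow> bool) \<Rightarrow> bool" where
  "connected_graph E \<longleftrightarrow> (\<forall>i j. E\<^sup>*\<^sup>* i j)"

definition adj :: "(nat \<Rightarrow> nat \<Rightarrow> bool) \<Rightarrow> nat \<Rightarrow> nat \<Rightarrow> 'k::zero_neq_one" where
  "adj E k i = (if E k i then 1 else 0)"

text \<open>The value is meaningful only if \<open>i\<close> has finitely many neighbours.\<close>

definition deg :: "(nat \<Rightarrow> nat \<Rightarrow> bool) \<Rightarrow> nat \<Rightarrow> nat" where
  "deg E i = card {k. E k i}"

definition bounded_degree :: "(nat \<Rightarrow> nat \<Rightarrow> bool) \<Rightarrow> bool" where
  "bounded_degree E \<longleftrightarrow> (\<exists>M>0. \<forall>i. finite {k. E k i} \<and> deg E i \<le> M)"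

definition regular_graph :: "(nat \<Rightarrow> nat \<Rightarrow> bool) \<Rightarrow> bool" where
  "regular_graph E \<longleftrightarrow> (\<exists>d. \<forall>i. deg E i = d)"

definition biregular_graph :: "(nat \<Rightarrow> nat \<Rightarrow> bool) \<Rightarrow> bool" where
  "biregular_graph E \<longleftrightarrow>
     (\<exists>V1 V2 d1 d2. V1 \<union> V2 = UNIV \<and> V1 \<inter> V2 = {} \<and>
        (\<forall>i j. E i j \<longrightarrow> (i \<in> V1 \<and> j \<in> V2) \<or> (i \<in> V2 \<and> j \<in> V1)) \<and>
        (\<forall>i\<in>V1. deg E i = d1) \<and> (\<forall>i\<in>V2. deg E i = d2))"

definition ell2 :: "(nat \<Rightarrow> 'k::real_normed_field) set" where
  "ell2 = {v. summable (\<lambda>i. (norm (v i))\<^sup>2)}"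

definition adjacency_operator ::
    "(nat \<Rightarrow> nat \<Rightarrow> bool) \<Rightarrow> (nat \<Rightarrow> 'k::real_normed_field) \<Rightarrow> nat \<Rightarrow> 'k" where
  "adjacency_operator E v = (\<lambda>k. \<Sum>i. v i * adj E k i)"

text \<open>The type argument selects the scalars of the sequence space.\<close>

definition nonsingular_graph ::
    "'k::real_normed_field itself \<Rightarrow> (nat \<Rightarrow> nat \<Rightarrow> bool) \<Rightarrow> bool" where
  "nonsingular_graph _ E \<longleftrightarrow>
     {v \<in> (ell2 :: (nat \<Rightarrow> 'k) set). adjacency_operator E v = (\<lambda>_. 0)} = {\<lambda>_. 0}"


section \<open>The two evolution algebras of a graph\<close>

definition graph_product ::
    "('k::rc_field \<Rightarrow> 'a::banach \<Rightarrow> 'a) \<Rightarrow> ('a \<Rightarrow> 'a \<Rightarrow> 'k) \<Rightarrow> (nat \<Rightarrow> 'a) \<Rightarrow>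
     (nat \<Rightarrow> nat \<Rightarrow> bool) \<Rightarrow> 'a \<Rightarrow> 'a \<Rightarrow> 'a" where
  "graph_product scl ip e E = evolution_product scl ip e (adj E)"

definition random_walk_product ::
    "('k::rc_field \<Rightarrow> 'a::banach \<Rightarrow> 'a) \<Rightarrow> ('a \<Rightarrow> 'a \<Rightarrow> 'k) \<Rightarrow> (nat \<Rightarrow> 'a) \<Rightarrow>
     (nat \<Rightarrow> nat \<Rightarrow> bool) \<Rightarrow> 'a \<Rightarrow> 'a \<Rightarrow> 'a" where
  "random_walk_product scl ip e E =
     evolution_product scl ip e (\<lambda>k i. adj E k i / of_nat (deg E i))"

end

theory Submission
  imports Defs
begin

text \<open>
  Both parts of the theorem pass through one condition on degrees: the product
  \<open>deg E k * deg E i\<close> takes the same value \<open>P\<close> on every edge. In a connected graph without isolated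
  vertices this is the same as being regular or biregular
  (\<open>regular_or_biregular_iff_degree_product_constant\<close>), because the degree of a vertex then
  determines the degree of each neighbour, so degrees alternate between two values along paths.

  A continuous linear map with \<open>e i \<mapsto> b i \<cdot> e (\<pi> i)\<close>, where \<open>\<pi>\<close> is the identity or any
  automorphism of the graph, carries the random walk product to the graph product exactly when
  \<open>b k = deg E i * (b i)\<^sup>2\<close> on every edge. For nonzero \<open>b i\<close>, the equations for the two orientations of an edge give
  \<open>b k * b i = deg E i * b i ^ 3 = deg E k * b k ^ 3\<close>. Connectedness makes the common value a
  constant \<open>\<gamma>\<close>, and cubing \<open>b k * b i = \<gamma>\<close> yields \<open>deg E k * deg E i * \<gamma> = 1\<close>. Conversely, if
  the degree product is \<open>P\<close>, then \<open>b i = root 3 (1 / (P * deg E i))\<close> solves the equations. It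
  takes finitely many values, so the diagonal map with these entries is a homeomorphism
  (\<open>isomorphic_if_degree_product_constant\<close>).

  Non-singularity is what forces an arbitrary isomorphism \<open>f\<close> into this monomial shape. Distinct
  basis vectors multiply to zero, so the adjacency operator kills the entrywise product of the
  coordinate sequences of \<open>f (e i)\<close> and \<open>f (e j)\<close>, and that product vanishes. The vectors \<open>f (e i)\<close>
  therefore have disjoint supports. If one support had two points, the coordinates of \<open>f x\<close> there
  would be proportional for all \<open>x\<close>, which contradicts surjectivity. Hence each \<open>f (e i)\<close> is a
  multiple of one basis vector (\<open>degree_product_constant_if_isomorphic\<close>).

  The analysis underneath expresses both products in coordinates. Products of two
  square-summable sequences are summable and the columns of the structure matrices are uniformly
  summable, so the series that define the products converge absolutely.
\<close>

section \<open>Coordinates in a Hilbert space with an orthonormal basis\<close>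

lemma rconj_zero [simp]: "rconj 0 = 0"
  using rconj_add[of 0 0] by simp

locale based_hilbert_space = hilbert_space scl ip
  for scl :: "'k::rc_field \<Rightarrow> 'a::banach \<Rightarrow> 'a"
    and ip :: "'a \<Rightarrow> 'a \<Rightarrow> 'k" +
  fixes e :: "nat \<Rightarrow> 'a"
  assumes basis: "orthonormal_basis scl ip e"
begin

lemma ip_basis: "ip (e i) (e j) = (if i = j then 1 else 0)"
  using basis by (simp add: orthonormal_basis_def)

lemma ip_zero_left [simp]: "ip 0 y = 0"
  using ip_add_left[of 0 0 y] by simp

lemma ip_sum_left: "ip (\<Sum>i\<in>S. f i) y = (\<Sum>i\<in>S. ip (f i) y)"
  by (induction S rule: infinite_finite_induct) (simp_all add: ip_add_left)

lemma ip_minus_left: "ip (- x) y = - ip x y"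
  using ip_add_left[of x "- x" y] by (simp add: eq_neg_iff_add_eq_0 add.commute)

lemma ip_diff_left: "ip (x - y) z = ip x z - ip y z"
  using ip_add_left[of x "- y" z] by (simp add: ip_minus_left)

lemma ip_eq_zero_commute: "ip x y = 0 \<Longrightarrow> ip y x = 0"
  using ip_commute[of y x] by simp

lemma ip_add_right: "ip x (y + z) = ip x y + ip x z"
  by (metis ip_add_left ip_commute rconj_add)

lemma norm_scl: "norm (scl a x) = norm a * norm x"
proof -
  have "of_real ((norm (scl a x))\<^sup>2) = a * rconj a * ip x x"
    by (metis ip_commute ip_scale_left ip_self mult.assoc mult.commute rconj_mult)
  also have "\<dots> = of_real ((norm a * norm x)\<^sup>2)"
    by (simp add: mult_rconj ip_self power_mult_distrib scaleR_conv_of_real)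
  finally have "(norm (scl a x))\<^sup>2 = (norm a * norm x)\<^sup>2"
    using of_real_eq_iff by blast
  then show ?thesis by (simp add: power2_eq_iff_nonneg)
qed

lemma norm_basis [simp]: "norm (e i) = 1"
proof -
  have "of_real ((norm (e i))\<^sup>2) = (of_real 1 :: 'k)"
    using ip_self[of "e i"] by (simp add: ip_basis)
  then have "(norm (e i))\<^sup>2 = 1" using of_real_eq_iff by blast
  then show ?thesis by (simp add: power2_eq_1_iff) (smt (verit) norm_ge_zero)
qed

lemma basis_nonzero: "e i \<noteq> 0"
  using norm_basis[of i] by force

lemma pythagoras:
  assumes "ip x y = 0"
  shows "(norm (x + y))\<^sup>2 = (norm x)\<^sup>2 + (norm y)\<^sup>2"
proof -
  have "of_real ((norm (x + y))\<^sup>2) = ip (x + y) (x + y)" by (simp add: ip_self)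
  also have "\<dots> = ip x x + ip y y"
    by (simp add: ip_add_left ip_add_right assms ip_eq_zero_commute[OF assms])
  also have "\<dots> = of_real ((norm x)\<^sup>2 + (norm y)\<^sup>2)" by (simp add: ip_self)
  finally show ?thesis using of_real_eq_iff by blast
qed

lemma norm_combination:
  assumes "finite S"
  shows "(norm (\<Sum>i\<in>S. scl (a i) (e i)))\<^sup>2 = (\<Sum>i\<in>S. (norm (a i))\<^sup>2)"
  using assms
proof (induction S)
  case (insert j S)
  have "ip (\<Sum>i\<in>S. scl (a i) (e i)) (e j) = 0"
    using insert(2) by (auto simp: ip_sum_left ip_scale_left ip_basis intro!: sum.neutral)
  then have "ip (e j) (\<Sum>i\<in>S. scl (a i) (e i)) = 0"
    by (rule ip_eq_zero_commute)
  then have "(norm (scl (a j) (e j) + (\<Sum>i\<in>S. scl (a i) (e i))))\<^sup>2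
      = (norm (scl (a j) (e j)))\<^sup>2 + (norm (\<Sum>i\<in>S. scl (a i) (e i)))\<^sup>2"
    by (intro pythagoras) (simp add: ip_scale_left)
  then show ?case using insert by (simp add: norm_scl)
qed simp

text \<open>Pythagoras for the projection \<open>s\<close> of \<open>x\<close> to finitely many basis vectors and the rest \<open>x - s\<close>.\<close>
lemma bessel:
  assumes "finite S"
  shows "(\<Sum>i\<in>S. (norm (ip x (e i)))\<^sup>2) \<le> (norm x)\<^sup>2"
proof -
  define s where "s = (\<Sum>i\<in>S. scl (ip x (e i)) (e i))"
  have "ip s (e j) = ip x (e j)" if "j \<in> S" for j
  proof -
    have "ip s (e j) = (\<Sum>i\<in>S. if i = j then ip x (e i) else 0)"
      unfolding s_def ip_sum_left by (intro sum.cong) (auto simp: ip_scale_left ip_basis)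
    then show ?thesis using assms that by simp
  qed
  then have "ip (x - s) (e j) = 0" if "j \<in> S" for j
    using that by (simp add: ip_diff_left)
  then have "ip (e j) (x - s) = 0" if "j \<in> S" for j
    using that ip_eq_zero_commute by blast
  then have "ip s (x - s) = 0"
    using ip_sum_left[of "\<lambda>i. scl (ip x (e i)) (e i)" S "x - s", folded s_def]
    by (metis (no_types, lifting) ip_scale_left mult_zero_right sum.neutral)
  then have "(norm (s + (x - s)))\<^sup>2 = (norm s)\<^sup>2 + (norm (x - s))\<^sup>2" by (rule pythagoras)
  then have "(norm s)\<^sup>2 \<le> (norm x)\<^sup>2" by simp
  then show ?thesis using norm_combination[OF assms, of "\<lambda>i. ip x (e i)"] by (simp add: s_def)
qed

lemma norm_coordinate_le: "norm (ip x (e k)) \<le> norm x"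
  using bessel[of "{k}" x] by (simp add: power2_le_iff_abs_le)

lemma summable_coordinates: "summable (\<lambda>i. (norm (ip x (e i)))\<^sup>2)"
  by (rule summableI_nonneg_bounded[where x = "(norm x)\<^sup>2"]) (simp_all add: bessel)

lemma bounded_linear_coordinate: "bounded_linear (\<lambda>x. ip x (e k))"
proof (rule bounded_linear_intro)
  show "ip (r *\<^sub>R x) (e k) = r *\<^sub>R ip x (e k)" for r x
    by (simp flip: scale_of_real add: ip_scale_left scaleR_conv_of_real)
  show "norm (ip x (e k)) \<le> norm x * 1" for x using norm_coordinate_le by simp
qed (rule ip_add_left)

lemma continuous_on_coordinate [continuous_intros]:
  "continuous_on S f \<Longrightarrow> continuous_on S (\<lambda>x. ip (f x) (e k))"
  by (rule bounded_linear.continuous_on[OF bounded_linear_coordinate])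

text \<open>
  A vector orthogonal to the basis is orthogonal to the span, so by Pythagoras its distance to the
  span is its own norm. Density of the span makes that distance zero.
\<close>
lemma coordinates_eqI:
  assumes "\<And>k. ip x (e k) = ip y (e k)"
  shows "x = y"
proof (rule ccontr)
  assume "x \<noteq> y"
  define z where "z = x - y"
  have "z \<noteq> 0" using \<open>x \<noteq> y\<close> by (simp add: z_def)
  have orth: "ip (e k) z = 0" for k
    by (rule ip_eq_zero_commute) (simp add: z_def ip_diff_left assms)
  have span: "ip s z = 0" if "s \<in> span (range e)" for s
    using that
  proof (induction rule: span_induct_alt)
    case (step a b y)
    then obtain k where "b = e k" by blast
    then show ?case using step(2) by (simp only: ip_add_left ip_scale_left orth mult_zero_right add_0)
  qed (rule ip_zero_left)
  have "z \<in> closure (span (range e))" using basis by (simp add: orthonormal_basis_def)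
  then obtain s where s: "s \<in> span (range e)" "dist s z < norm z"
    using \<open>z \<noteq> 0\<close> unfolding closure_approachable by (metis zero_less_norm_iff)
  have "ip (- s) z = 0" by (simp add: ip_minus_left span s(1))
  then have "(norm (- s + z))\<^sup>2 = (norm (- s))\<^sup>2 + (norm z)\<^sup>2" by (rule pythagoras)
  then have "(norm z)\<^sup>2 \<le> (dist s z)\<^sup>2" by (simp add: dist_norm norm_minus_commute)
  then show False using s(2) by (simp add: power2_le_iff_abs_le)
qed

text \<open>
  Continuity extends the formula from the span of the basis to the whole space. This replaces the
  expansion of \<open>x\<close> in the basis when the matrix of an operator is studied row by row.
\<close>
lemma continuous_functional_coordinate:
  fixes \<phi> :: "'a \<Rightarrow> 'k"
  assumes add: "\<And>x y. \<phi> (x + y) = \<phi> x + \<phi> y"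
    and scl: "\<And>a x. \<phi> (scl a x) = a * \<phi> x"
    and cont: "continuous_on UNIV \<phi>"
    and zero: "\<And>j. j \<noteq> i \<Longrightarrow> \<phi> (e j) = 0"
  shows "\<phi> x = \<phi> (e i) * ip x (e i)"
proof -
  define K where "K = {x. \<phi> x = \<phi> (e i) * ip x (e i)}"
  have "closed K" unfolding K_def by (intro closed_Collect_eq continuous_intros cont)
  have "\<phi> 0 = 0" using scl[of 0 0] by simp
  have "s \<in> K" if "s \<in> span (range e)" for s
    using that
  proof (induction rule: span_induct_alt)
    case (step a b y)
    then obtain j where "b = e j" by blast
    moreover have "\<phi> (e j) = \<phi> (e i) * ip (e j) (e i)"
      by (simp add: ip_basis zero)
    ultimately show ?case
      using step(2) by (simp add: K_def add scl ip_add_left ip_scale_left algebra_simps)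
  qed (simp add: K_def \<open>\<phi> 0 = 0\<close>)
  then have "closure (span (range e)) \<subseteq> K"
    using \<open>closed K\<close> by (intro closure_minimal) auto
  then show ?thesis using basis by (auto simp: orthonormal_basis_def K_def)
qed

lemma coordinate_of_sums:
  assumes "(\<lambda>k. scl (a k) (e k)) sums x"
  shows "ip x (e k) = a k"
proof -
  have "(\<lambda>j. ip (scl (a j) (e j)) (e k)) sums ip x (e k)"
    by (rule bounded_linear.sums[OF bounded_linear_coordinate assms])
  moreover have "(\<lambda>j. ip (scl (a j) (e j)) (e k)) = (\<lambda>j. if j = k then a j else 0)"
    by (auto simp: ip_scale_left ip_basis)
  ultimately show ?thesis using sums_single[of k a] sums_unique2 by metis
qed

text \<open>By \<open>norm_combination\<close>, the Cauchy criterion for the squared norms is the one for the vectors.\<close>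
lemma riesz_fischer:
  assumes "summable (\<lambda>k. (norm (a k))\<^sup>2)"
  shows "summable (\<lambda>k. scl (a k) (e k))"
  unfolding summable_Cauchy
proof (intro allI impI)
  fix \<epsilon> :: real assume "\<epsilon> > 0"
  then have "\<epsilon>\<^sup>2 > 0" by simp
  then obtain N where N: "\<And>m n. m \<ge> N \<Longrightarrow> norm (\<Sum>k\<in>{m..<n}. (norm (a k))\<^sup>2) < \<epsilon>\<^sup>2"
    using assms unfolding summable_Cauchy by blast
  have "norm (\<Sum>k\<in>{m..<n}. scl (a k) (e k)) < \<epsilon>" if "m \<ge> N" for m n
  proof (rule power2_less_imp_less)
    show "(norm (\<Sum>k\<in>{m..<n}. scl (a k) (e k)))\<^sup>2 < \<epsilon>\<^sup>2"
      using N[OF that, of n] by (subst norm_combination) auto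
  qed (use \<open>\<epsilon> > 0\<close> in simp)
  then show "\<exists>N. \<forall>m\<ge>N. \<forall>n. norm (\<Sum>k\<in>{m..<n}. scl (a k) (e k)) < \<epsilon>" by blast
qed

lemma continuous_on_bounded_linear_map:
  assumes "Vector_Spaces.linear scl scl f"
    and "\<And>x. norm (f x) \<le> B * norm x"
  shows "continuous_on UNIV f"
proof -
  have "f (r *\<^sub>R x) = r *\<^sub>R f x" for r x
    using assms(1) by (simp flip: scale_of_real add: Vector_Spaces.linear_iff)
  then have "bounded_linear f"
    using assms by (intro bounded_linear_intro[where K = B])
      (auto simp: Vector_Spaces.linear_iff mult.commute)
  then show ?thesis by (rule linear_continuous_on)
qed

lemma linear_mapI:
  assumes "\<And>x y. f (x + y) = f x + f y" "\<And>a x. f (scl a x) = scl a (f x)"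
  shows "Vector_Spaces.linear scl scl f"
  using assms vector_space_axioms by (simp add: Vector_Spaces.linear_iff)


section \<open>Diagonal operators\<close>

definition diagonal_map :: "(nat \<Rightarrow> 'k) \<Rightarrow> 'a \<Rightarrow> 'a" where
  "diagonal_map b x = (\<Sum>k. scl (b k * ip x (e k)) (e k))"

lemma diagonal_map_sums:
  assumes "bounded (range b)"
  shows "(\<lambda>k. scl (b k * ip x (e k)) (e k)) sums diagonal_map b x"
proof -
  obtain B where B: "\<And>k. norm (b k) \<le> B" using assms by (auto simp: bounded_iff)
  have "(norm (b k * ip x (e k)))\<^sup>2 \<le> B\<^sup>2 * (norm (ip x (e k)))\<^sup>2" for k
    unfolding norm_mult power_mult_distrib by (intro mult_right_mono power_mono B) auto
  then have "summable (\<lambda>k. (norm (b k * ip x (e k)))\<^sup>2)"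
    by (intro summable_comparison_test'[OF summable_mult[OF summable_coordinates]]) simp
  then show ?thesis unfolding diagonal_map_def by (intro summable_sums riesz_fischer)
qed

lemma diagonal_map_coordinate:
  "bounded (range b) \<Longrightarrow> ip (diagonal_map b x) (e k) = b k * ip x (e k)"
  by (rule coordinate_of_sums[OF diagonal_map_sums])

lemma diagonal_map_linear:
  "bounded (range b) \<Longrightarrow> Vector_Spaces.linear scl scl (diagonal_map b)"
  by (intro linear_mapI coordinates_eqI)
    (simp_all add: diagonal_map_coordinate ip_add_left ip_scale_left algebra_simps)

lemma diagonal_map_continuous:
  assumes b: "bounded (range b)"
  shows "continuous_on UNIV (diagonal_map b)"
proof -
  obtain B where "B > 0" and B: "\<And>k. norm (b k) \<le> B"
    using b by (auto simp: bounded_pos)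
  have "norm (diagonal_map b x) \<le> B * norm x" for x
  proof (rule LIMSEQ_le_const2)
    show "(\<lambda>n. norm (\<Sum>k<n. scl (b k * ip x (e k)) (e k))) \<longlonglongrightarrow> norm (diagonal_map b x)"
      using diagonal_map_sums[OF b, of x] unfolding sums_def by (rule tendsto_norm)
    have "norm (\<Sum>k<n. scl (b k * ip x (e k)) (e k)) \<le> B * norm x" for n
    proof (rule power2_le_imp_le)
      have "(norm (\<Sum>k<n. scl (b k * ip x (e k)) (e k)))\<^sup>2 = (\<Sum>k<n. (norm (b k * ip x (e k)))\<^sup>2)"
        by (rule norm_combination) simp
      also have "\<dots> \<le> (\<Sum>k<n. B\<^sup>2 * (norm (ip x (e k)))\<^sup>2)"
        unfolding norm_mult power_mult_distrib
        by (intro sum_mono mult_right_mono power_mono B) auto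
      also have "\<dots> \<le> B\<^sup>2 * (norm x)\<^sup>2"
        unfolding sum_distrib_left[symmetric] by (intro mult_left_mono bessel) auto
      finally show "(norm (\<Sum>k<n. scl (b k * ip x (e k)) (e k)))\<^sup>2 \<le> (B * norm x)\<^sup>2"
        by (simp add: power_mult_distrib)
    qed (use \<open>B > 0\<close> in simp)
    then show "\<exists>N. \<forall>n\<ge>N. norm (\<Sum>k<n. scl (b k * ip x (e k)) (e k)) \<le> B * norm x" by blast
  qed
  then show ?thesis by (intro continuous_on_bounded_linear_map diagonal_map_linear b)
qed

lemma diagonal_map_inverse:
  assumes "bounded (range b)" "bounded (range c)" "\<And>k. b k * c k = 1"
  shows "diagonal_map b (diagonal_map c x) = x"
  using assms by (intro coordinates_eqI) (simp add: diagonal_map_coordinate flip: mult.assoc)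


section \<open>Evolution products\<close>

text \<open>The Cauchy--Schwarz inequality for finite sums, with Bessel's inequality for each factor.\<close>
lemma sum_norm_coordinate_products_le:
  "(\<Sum>i<n. norm (ip v (e i) * ip w (e i))) \<le> norm v * norm w"
proof -
  have L2: "L2_set (\<lambda>i. norm (ip x (e i))) {..<n} \<le> norm x" for x
    unfolding L2_set_def by (rule real_le_lsqrt) (simp_all add: bessel sum_nonneg)
  have "(\<Sum>i<n. norm (ip v (e i) * ip w (e i)))
      \<le> L2_set (\<lambda>i. norm (ip v (e i))) {..<n} * L2_set (\<lambda>i. norm (ip w (e i))) {..<n}"
    using L2_set_mult_ineq[of "\<lambda>i. norm (ip v (e i))" "\<lambda>i. norm (ip w (e i))" "{..<n}"]
    by (simp add: norm_mult)
  also have "\<dots> \<le> norm v * norm w" by (intro mult_mono L2) auto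
  finally show ?thesis .
qed

lemma summable_norm_coordinate_products:
  "summable (\<lambda>i. norm (ip v (e i) * ip w (e i)))"
  by (rule summableI_nonneg_bounded[OF _ sum_norm_coordinate_products_le]) simp

text \<open>
  Columns with uniformly bounded \<open>\<ell>\<^sup>1\<close> norm suffice for everything below: they make the operator with
  matrix \<open>c\<close> bounded on \<open>\<ell>\<^sup>1\<close>, and the entrywise product of two coordinate sequences lies in \<open>\<ell>\<^sup>1\<close>.
\<close>
context
  fixes c :: "nat \<Rightarrow> nat \<Rightarrow> 'k" and M :: real
  assumes columns: "\<And>i n. (\<Sum>k<n. norm (c k i)) \<le> M"
begin

private lemma entry_le: "norm (c k i) \<le> M"
proof -
  have "norm (c k i) \<le> (\<Sum>j<Suc k. norm (c j i))"
    by (rule member_le_sum[where f = "\<lambda>j. norm (c j i)"]) auto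
  then show ?thesis using columns order_trans by blast
qed

private lemma M_nonneg: "M \<ge> 0"
  using columns[where n = 0] by simp

private lemma summable_norm_terms:
  "summable (\<lambda>i. norm (ip v (e i) * ip w (e i) * c k i))"
proof (rule summable_comparison_test')
  show "summable (\<lambda>i. norm (ip v (e i) * ip w (e i)) * M)"
    by (intro summable_mult2 summable_norm_coordinate_products)
  show "norm (norm (ip v (e i) * ip w (e i) * c k i)) \<le> norm (ip v (e i) * ip w (e i)) * M"
    for i
    by (simp add: norm_mult[of _ "c k i"] mult_left_mono entry_le)
qed

lemma summable_evolution_terms: "summable (\<lambda>i. ip v (e i) * ip w (e i) * c k i)"
  by (rule summable_norm_cancel[OF summable_norm_terms])

text \<open>
  Only finitely many rows are summed, so exchanging this sum with the series over \<open>i\<close> is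
  elementary, and afterwards the bound on the columns applies.
\<close>
private lemma sum_norm_evolution_coefficients_le:
  "(\<Sum>k<n. norm (\<Sum>i. ip v (e i) * ip w (e i) * c k i)) \<le> M * (norm v * norm w)"
proof -
  let ?u = "\<lambda>i. ip v (e i) * ip w (e i)"
  have "(\<Sum>k<n. norm (\<Sum>i. ?u i * c k i)) \<le> (\<Sum>k<n. \<Sum>i. norm (?u i * c k i))"
    by (intro sum_mono summable_norm summable_norm_terms)
  also have "\<dots> = (\<Sum>i. \<Sum>k<n. norm (?u i * c k i))"
    by (intro suminf_sum[symmetric] summable_norm_terms)
  also have "\<dots> \<le> (\<Sum>i. norm (?u i) * M)"
  proof (rule suminf_le)
    show "(\<Sum>k<n. norm (?u i * c k i)) \<le> norm (?u i) * M" for i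
      unfolding norm_mult[of "?u i"] sum_distrib_left[symmetric]
      by (intro mult_left_mono columns norm_ge_zero)
    show "summable (\<lambda>i. \<Sum>k<n. norm (?u i * c k i))"
      by (intro summable_sum summable_norm_terms)
  qed (intro summable_mult2 summable_norm_coordinate_products)
  also have "\<dots> = (\<Sum>i. norm (?u i)) * M"
    by (intro suminf_mult2[symmetric] summable_norm_coordinate_products)
  also have "\<dots> \<le> (norm v * norm w) * M"
    by (intro mult_right_mono suminf_le_const summable_norm_coordinate_products
        sum_norm_coordinate_products_le M_nonneg)
  finally show ?thesis by (simp add: mult.commute)
qed

lemma evolution_product_sums:
  "(\<lambda>k. scl (\<Sum>i. ip v (e i) * ip w (e i) * c k i) (e k)) sums evolution_product scl ip e c v w"
proof -
  have "summable (\<lambda>k. norm (\<Sum>i. ip v (e i) * ip w (e i) * c k i))"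
    by (rule summableI_nonneg_bounded[OF _ sum_norm_evolution_coefficients_le]) simp
  then have "summable (\<lambda>k. norm (scl (\<Sum>i. ip v (e i) * ip w (e i) * c k i) (e k)))"
    by (simp add: norm_scl)
  then show ?thesis
    unfolding evolution_product_def by (rule summable_sums[OF summable_norm_cancel])
qed

lemma evolution_product_coordinate:
  "ip (evolution_product scl ip e c v w) (e k) = (\<Sum>i. ip v (e i) * ip w (e i) * c k i)"
  by (rule coordinate_of_sums[OF evolution_product_sums])

lemma norm_evolution_product_le:
  "norm (evolution_product scl ip e c v w) \<le> M * norm v * norm w"
proof (rule LIMSEQ_le_const2)
  let ?s = "\<lambda>n. \<Sum>k<n. scl (\<Sum>i. ip v (e i) * ip w (e i) * c k i) (e k)"
  show "(\<lambda>n. norm (?s n)) \<longlonglongrightarrow> norm (evolution_product scl ip e c v w)"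
    using evolution_product_sums unfolding sums_def by (rule tendsto_norm)
  have "norm (?s n) \<le> M * norm v * norm w" for n
    using norm_sum[of "\<lambda>k. scl (\<Sum>i. ip v (e i) * ip w (e i) * c k i) (e k)" "{..<n}"]
      sum_norm_evolution_coefficients_le[where n = n and v = v and w = w]
    by (simp add: norm_scl mult.assoc)
  then show "\<exists>N. \<forall>n\<ge>N. norm (?s n) \<le> M * norm v * norm w" by blast
qed

lemma evolution_product_basis_coordinate:
  "ip (evolution_product scl ip e c (e i) (e j)) (e k) = (if i = j then c k i else 0)"
proof -
  have "(\<Sum>m. ip (e i) (e m) * ip (e j) (e m) * c k m)
      = (\<Sum>m. if m = i then (if i = j then c k i else 0) else 0)"
    by (intro suminf_cong) (auto simp: ip_basis)
  also have "\<dots> = (if i = j then c k i else 0)"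
    using sums_unique[OF sums_single[of i "\<lambda>_. if i = j then c k i else 0"]] by simp
  finally show ?thesis by (simp add: evolution_product_coordinate)
qed

lemma hilbert_evolution_algebra_evolution_product:
  "hilbert_evolution_algebra scl ip (evolution_product scl ip e c)"
proof -
  let ?mul = "evolution_product scl ip e c"
  have commute: "?mul v w = ?mul w v" for v w
    by (simp add: evolution_product_def mult.commute mult.left_commute)
  have add: "?mul v (w + w') = ?mul v w + ?mul v w'" for v w w'
  proof (rule coordinates_eqI)
    fix k
    have "(\<Sum>i. ip v (e i) * ip (w + w') (e i) * c k i) =
        (\<Sum>i. ip v (e i) * ip w (e i) * c k i + ip v (e i) * ip w' (e i) * c k i)"
      by (intro suminf_cong) (simp add: ip_add_left algebra_simps)
    also have "\<dots> = (\<Sum>i. ip v (e i) * ip w (e i) * c k i) +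
        (\<Sum>i. ip v (e i) * ip w' (e i) * c k i)"
      by (intro suminf_add[symmetric] summable_evolution_terms)
    finally show "ip (?mul v (w + w')) (e k) = ip (?mul v w + ?mul v w') (e k)"
      by (simp add: evolution_product_coordinate ip_add_left)
  qed
  have scale: "?mul v (scl a w) = scl a (?mul v w)" for a v w
  proof (rule coordinates_eqI)
    fix k
    have "(\<Sum>i. ip v (e i) * ip (scl a w) (e i) * c k i) =
        (\<Sum>i. a * (ip v (e i) * ip w (e i) * c k i))"
      by (intro suminf_cong) (simp add: ip_scale_left algebra_simps)
    also have "\<dots> = a * (\<Sum>i. ip v (e i) * ip w (e i) * c k i)"
      by (intro suminf_mult summable_evolution_terms)
    finally show "ip (?mul v (scl a w)) (e k) = ip (scl a (?mul v w)) (e k)"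
      by (simp add: evolution_product_coordinate ip_scale_left)
  qed
  have right: "Vector_Spaces.linear scl scl (?mul v)" for v
    by (intro linear_mapI add scale)
  have "(\<lambda>k. scl (c k i) (e k)) sums ?mul (e i) (e i)" for i
    using evolution_product_sums[of "e i" "e i"]
    by (simp flip: evolution_product_coordinate add: evolution_product_basis_coordinate)
  moreover have "?mul (e i) (e j) = 0" if "i \<noteq> j" for i j
    using that by (intro coordinates_eqI) (simp add: evolution_product_basis_coordinate)
  ultimately have "evolution_basis scl ip ?mul e c"
    unfolding evolution_basis_def
    using basis summable_evolution_terms evolution_product_sums by blast
  moreover have "continuous_on UNIV (?mul v)" for v
    by (rule continuous_on_bounded_linear_map[OF right norm_evolution_product_le])
  moreover have "Vector_Spaces.linear scl scl (\<lambda>v. ?mul v w)" for w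
    unfolding commute[of _ w] by (rule right)
  ultimately show ?thesis
    using right hilbert_space_axioms
    unfolding hilbert_evolution_algebra_def hilbert_evolution_algebra_axioms_def by blast
qed

end

section \<open>The two algebras of a graph in coordinates\<close>

text \<open>
  The maximal degree bounds the columns of the adjacency matrix, and dividing by a degree does not
  enlarge an entry: a degree is at least \<open>1\<close>, or it is \<open>0\<close> and the quotient is \<open>0\<close> by convention.
\<close>
lemma bounded_adjacency_columns:
  assumes "bounded_degree E"
  obtains M :: real
  where "\<And>i n. (\<Sum>k<n. norm (adj E k i :: 'k)) \<le> M"
    and "\<And>i n. (\<Sum>k<n. norm (adj E k i / of_nat (deg E i) :: 'k)) \<le> M"
proof -
  obtain M where fin: "\<And>i. finite {k. E k i}" and le: "\<And>i. deg E i \<le> M"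
    using assms by (auto simp: bounded_degree_def)
  have adj: "(\<Sum>k<n. norm (adj E k i :: 'k)) \<le> real M" for i n
  proof -
    have "(\<Sum>k<n. norm (adj E k i :: 'k)) = (\<Sum>k<n. if k \<in> {k. E k i} then 1 else 0)"
      by (intro sum.cong) (auto simp: adj_def)
    also have "\<dots> = real (card ({..<n} \<inter> {k. E k i}))"
      by (subst sum.inter_restrict[symmetric]) simp_all
    also have "\<dots> \<le> real (deg E i)"
      unfolding deg_def by (intro of_nat_mono card_mono fin) simp
    also have "\<dots> \<le> real M" using le by simp
    finally show ?thesis .
  qed
  have "norm (adj E k i / of_nat (deg E i) :: 'k) \<le> norm (adj E k i :: 'k)" for k i
    by (cases "deg E i") (simp_all add: norm_divide divide_le_eq mult_left_le adj_def del: of_nat_Suc)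
  then have "(\<Sum>k<n. norm (adj E k i / of_nat (deg E i) :: 'k)) \<le> real M" for i n
    by (intro order_trans[OF sum_mono adj])
  with adj show ?thesis by (rule that)
qed

context
  fixes E :: "nat \<Rightarrow> nat \<Rightarrow> bool"
  assumes bounded: "bounded_degree E"
begin

lemma graph_product_coordinate:
  "ip (graph_product scl ip e E v w) (e k) = (\<Sum>i. ip v (e i) * ip w (e i) * adj E k i)"
  unfolding graph_product_def
  by (rule bounded_adjacency_columns[OF bounded], rule evolution_product_coordinate)

lemma random_walk_product_coordinate:
  "ip (random_walk_product scl ip e E v w) (e k)
    = (\<Sum>i. ip v (e i) * ip w (e i) * (adj E k i / of_nat (deg E i)))"
  unfolding random_walk_product_def
  by (rule bounded_adjacency_columns[OF bounded], rule evolution_product_coordinate)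

lemma random_walk_product_basis_coordinate:
  "ip (random_walk_product scl ip e E (e i) (e j)) (e k)
    = (if i = j then adj E k i / of_nat (deg E i) else 0)"
  unfolding random_walk_product_def
  by (rule bounded_adjacency_columns[OF bounded], rule evolution_product_basis_coordinate)

lemma hilbert_evolution_algebra_graph_product:
  "hilbert_evolution_algebra scl ip (graph_product scl ip e E)"
  unfolding graph_product_def
  by (rule bounded_adjacency_columns[OF bounded],
      rule hilbert_evolution_algebra_evolution_product)

lemma hilbert_evolution_algebra_random_walk_product:
  "hilbert_evolution_algebra scl ip (random_walk_product scl ip e E)"
  unfolding random_walk_product_def
  by (rule bounded_adjacency_columns[OF bounded],
      rule hilbert_evolution_algebra_evolution_product)


section \<open>Constant degree products give an isomorphism\<close>

text \<open>
  Comparing the coefficients of \<open>ip v (e i) * ip w (e i)\<close> in the \<open>k\<close>-th coordinates of both sides of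
  the homomorphism equation leaves exactly the condition \<open>edge\<close>.
\<close>
lemma diagonal_isomorphism:
  fixes b :: "nat \<Rightarrow> 'k"
  assumes b: "bounded (range b)" "bounded (range (\<lambda>i. inverse (b i)))" "\<And>i. b i \<noteq> 0"
    and edge: "\<And>k i. E k i \<Longrightarrow> b k = of_nat (deg E i) * (b i)\<^sup>2"
  shows "hea_isomorphic scl ip (random_walk_product scl ip e E)
    scl ip (graph_product scl ip e E)"
proof -
  let ?f = "diagonal_map b" and ?g = "diagonal_map (\<lambda>i. inverse (b i))"
  have gf: "?g (?f x) = x" and fg: "?f (?g x) = x" for x
    using b by (intro diagonal_map_inverse; simp)+
  have "bij ?f" by (rule o_bij[of ?g]) (auto simp: gf fg)
  have "inv ?f = ?g" by (rule inv_equality) (auto simp: gf fg)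
  have "?f (random_walk_product scl ip e E v w) = graph_product scl ip e E (?f v) (?f w)" for v w
  proof (rule coordinates_eqI)
    fix k
    have entry: "b k * (adj E k i / of_nat (deg E i)) = (b i)\<^sup>2 * adj E k i" for i
    proof (cases "E k i")
      case True
      then have "of_nat (deg E i) \<noteq> (0 :: 'k)" using edge b(3)[of k] by fastforce
      then show ?thesis using edge[OF True] True by (simp add: adj_def)
    qed (simp add: adj_def)
    have terms_eq: "b k * (ip v (e i) * ip w (e i) * (adj E k i / of_nat (deg E i)))
        = b i * ip v (e i) * (b i * ip w (e i)) * adj E k i" for i
    proof -
      have "b k * (ip v (e i) * ip w (e i) * (adj E k i / of_nat (deg E i)))
          = ip v (e i) * ip w (e i) * (b k * (adj E k i / of_nat (deg E i)))"
        by (rule mult.left_commute)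
      also have "\<dots> = b i * ip v (e i) * (b i * ip w (e i)) * adj E k i"
        unfolding entry by (simp add: power2_eq_square ac_simps)
      finally show ?thesis .
    qed
    have "summable (\<lambda>i. ip v (e i) * ip w (e i) * (adj E k i / of_nat (deg E i)))"
      by (rule bounded_adjacency_columns[OF bounded], rule summable_evolution_terms)
    then have "b k * (\<Sum>i. ip v (e i) * ip w (e i) * (adj E k i / of_nat (deg E i)))
        = (\<Sum>i. b i * ip v (e i) * (b i * ip w (e i)) * adj E k i)"
      by (simp only: suminf_mult[symmetric] terms_eq)
    then show "ip (?f (random_walk_product scl ip e E v w)) (e k)
        = ip (graph_product scl ip e E (?f v) (?f w)) (e k)"
      by (simp add: diagonal_map_coordinate[OF b(1)] graph_product_coordinate
          random_walk_product_coordinate)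
  qed
  then have "hea_hom scl (random_walk_product scl ip e E) scl (graph_product scl ip e E) ?f"
    unfolding hea_hom_def by (intro conjI allI diagonal_map_linear diagonal_map_continuous b)
  moreover have "continuous_on UNIV (inv ?f)"
    unfolding \<open>inv ?f = ?g\<close> by (rule diagonal_map_continuous[OF b(2)])
  ultimately show ?thesis
    unfolding hea_isomorphic_def using \<open>bij ?f\<close>
      hilbert_evolution_algebra_graph_product hilbert_evolution_algebra_random_walk_product
    by blast
qed

text \<open>
  Nonzero entries are forced: on an edge, \<open>b k = deg E i * (b i)\<^sup>2\<close> and \<open>b i = deg E k * (b k)\<^sup>2\<close> give
  \<open>deg E k * (deg E i)\<^sup>2 * b i ^ 3 = 1\<close>. Since \<open>P\<close> is positive, the real cube root can be used for
  real and complex scalars alike.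
\<close>
lemma isomorphic_if_degree_product_constant:
  assumes pos: "\<And>i. deg E i > 0" and P: "P > 0"
    and prod: "\<And>k i. E k i \<Longrightarrow> deg E k * deg E i = P"
  shows "hea_isomorphic scl ip (random_walk_product scl ip e E)
    scl ip (graph_product scl ip e E)"
proof -
  define r where "r i = root 3 (1 / (P * deg E i))" for i
  have cube: "r i ^ 3 = 1 / (P * deg E i)" for i
    unfolding r_def by (rule odd_real_root_pow) simp
  have r_nonzero: "r i \<noteq> 0" for i using pos[of i] P by (simp add: r_def)
  have edge: "r k = deg E i * (r i)\<^sup>2" if "E k i" for k i
  proof -
    have P_eq: "real P = deg E k * deg E i" using prod[OF that] by (metis of_nat_mult)
    have "(deg E i * (r i)\<^sup>2) ^ 3 = deg E i ^ 3 * (r i ^ 3)\<^sup>2"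
      by (simp add: power_mult_distrib flip: power_mult)
    also have "\<dots> = r k ^ 3"
      unfolding cube of_nat_mult P_eq using pos[of i] pos[of k] by (simp add: field_simps eval_nat_numeral)
    finally show ?thesis
      using odd_real_root_power_cancel[of 3] by (metis odd_numeral)
  qed
  \<comment> \<open>Bounded degrees take finitely many values, so the entries and their inverses are bounded.\<close>
  have "finite (range (deg E))"
    using bounded finite_subset[of "range (deg E)" "{.._}"] by (auto simp: bounded_degree_def)
  then have fin: "finite (range (\<lambda>i. h (deg E i)))" for h :: "nat \<Rightarrow> 'k"
    by (simp flip: image_image)
  show ?thesis
  proof (rule diagonal_isomorphism[where b = "\<lambda>i. of_real (r i)"])
    show "bounded (range (\<lambda>i. of_real (r i) :: 'k))"
      "bounded (range (\<lambda>i. inverse (of_real (r i)) :: 'k))"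
      unfolding r_def by (intro finite_imp_bounded fin)+
  qed (use edge r_nonzero in auto)
qed


section \<open>An isomorphism forces constant degree products\<close>

text \<open>
  The isomorphism \<open>f\<close> is shown to be monomial, \<open>f (e i) = \<beta> i \<cdot> e (\<pi> i)\<close> with
  \<open>\<beta> i \<noteq> 0\<close>. The coordinate of \<open>f (e i \<cdot> e i) = f (e i) \<cdot> f (e i)\<close> at \<open>\<pi> k\<close>, for a neighbour
  \<open>k\<close> of \<open>i\<close>, then gives the equations for the \<open>\<beta> i\<close> that fix the degree product.
\<close>
lemma degree_product_constant_if_isomorphic:
  assumes connected: "connected_graph E" and sym: "symp E"
    and nonsingular: "nonsingular_graph TYPE('k) E"
    and iso: "hea_isomorphic scl ip (random_walk_product scl ip e E)
      scl ip (graph_product scl ip e E)"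
  shows "\<exists>P. \<forall>k i. E k i \<longrightarrow> deg E k * deg E i = P"
proof -
  obtain f where lin: "Vector_Spaces.linear scl scl f" and cont: "continuous_on UNIV f"
    and hom: "\<And>v w. f (random_walk_product scl ip e E v w) = graph_product scl ip e E (f v) (f w)"
    and "bij f"
    using iso by (auto simp: hea_isomorphic_def hea_hom_def)
  have f_add: "f (x + y) = f x + f y" and f_scl: "f (scl a x) = scl a (f x)" for a x y
    using lin by (simp_all add: Vector_Spaces.linear_iff)
  have f_zero: "f 0 = 0" using f_add[of 0 0] by simp
  define t where "t k i = ip (f (e i)) (e k)" for k i

  \<comment> \<open>The supports of the columns of \<open>t\<close> are disjoint, because the adjacency operator is injective.\<close>
  have disjoint: "t k i * t k j = 0" if "i \<noteq> j" for i j k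
  proof -
    let ?v = "\<lambda>m. t m i * t m j"
    have "random_walk_product scl ip e E (e i) (e j) = 0"
      using that by (intro coordinates_eqI) (simp add: random_walk_product_basis_coordinate)
    then have "graph_product scl ip e E (f (e i)) (f (e j)) = 0" using hom f_zero by metis
    then have "adjacency_operator E ?v = (\<lambda>_. 0)"
      using graph_product_coordinate[of "f (e i)" "f (e j)"]
      by (simp add: adjacency_operator_def t_def fun_eq_iff)
    moreover have "?v \<in> ell2"
    proof -
      have "norm ((norm (?v m))\<^sup>2) \<le> (norm (f (e i)))\<^sup>2 * (norm (t m j))\<^sup>2" for m
        using norm_coordinate_le[of "f (e i)" m]
        by (simp add: norm_mult power_mult_distrib t_def mult_right_mono power_mono)
      then have "summable (\<lambda>m. (norm (?v m))\<^sup>2)"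
        unfolding t_def
        by (intro summable_comparison_test'[OF summable_mult[OF summable_coordinates]]) blast
      then show ?thesis by (simp add: ell2_def)
    qed
    ultimately have "?v = (\<lambda>_. 0)" using nonsingular by (auto simp: nonsingular_graph_def)
    then show ?thesis by meson
  qed

  \<comment> \<open>A row of \<open>t\<close> with one nonzero entry determines the corresponding coordinate of \<open>f\<close>.\<close>
  have coordinate: "ip (f x) (e k) = t k i * ip x (e i)" if "t k i \<noteq> 0" for k i x
    unfolding t_def
  proof (rule continuous_functional_coordinate[where \<phi> = "\<lambda>x. ip (f x) (e k)"])
    show "ip (f (e j)) (e k) = 0" if "j \<noteq> i" for j
      using disjoint[OF that, of k] \<open>t k i \<noteq> 0\<close> by (simp add: t_def)
  qed (simp_all add: f_add f_scl ip_add_left ip_scale_left continuous_on_coordinate cont)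

  \<comment> \<open>Two points in one support would tie two coordinates of \<open>f x\<close> together, but \<open>f\<close> reaches \<open>e k\<close>.\<close>
  have single: "m = k" if "t k i \<noteq> 0" "t m i \<noteq> 0" for k m i
  proof (rule ccontr)
    assume "m \<noteq> k"
    obtain x where x: "f x = e k" using \<open>bij f\<close> by (metis bij_pointE)
    have "t m i * ip x (e i) = 0"
      using coordinate[OF that(2), of x] \<open>m \<noteq> k\<close> by (simp add: x ip_basis)
    then show False using coordinate[OF that(1), of x] that(2) by (simp add: x ip_basis)
  qed

  have "\<exists>k. t k i \<noteq> 0" for i
  proof (rule ccontr)
    assume "\<nexists>k. t k i \<noteq> 0"
    then have "f (e i) = f 0" by (intro coordinates_eqI) (simp add: t_def f_zero)
    then show False using \<open>bij f\<close> basis_nonzero by (metis bij_pointE)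
  qed
  then obtain \<pi> where \<pi>: "\<And>i. t (\<pi> i) i \<noteq> 0" by metis
  define \<beta> where "\<beta> i = t (\<pi> i) i" for i
  have \<beta>_nonzero: "\<beta> i \<noteq> 0" for i using \<pi> by (simp add: \<beta>_def)
  have t_eq: "t k i = (if k = \<pi> i then \<beta> i else 0)" for k i
    using single[OF \<pi>, of k i] by (auto simp: \<beta>_def)

  have edge: "\<beta> k = of_nat (deg E i) * (\<beta> i)\<^sup>2" "deg E i \<noteq> 0" if "E k i" for k i
  proof -
    have "finite {k. E k i}" using bounded unfolding bounded_degree_def by blast
    then show d: "deg E i \<noteq> 0" using that by (auto simp: deg_def)
    \<comment> \<open>Compare the coordinates of \<open>f (e i \<cdot> e i)\<close> and \<open>f (e i) \<cdot> f (e i)\<close> at \<open>\<pi> k\<close>. The left one is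
      nonzero, which also shows that \<open>\<pi>\<close> preserves the edge.\<close>
    have "\<beta> k * (1 / of_nat (deg E i)) = ip (f (random_walk_product scl ip e E (e i) (e i))) (e (\<pi> k))"
      using that by (simp add: coordinate[OF \<pi>] random_walk_product_basis_coordinate adj_def \<beta>_def)
    also have "\<dots> = (\<Sum>m. t m i * t m i * adj E (\<pi> k) m)"
      by (simp add: hom graph_product_coordinate t_def)
    also have "\<dots> = (\<Sum>m. if m = \<pi> i then (\<beta> i)\<^sup>2 * adj E (\<pi> k) m else 0)"
      by (intro suminf_cong) (simp add: t_eq power2_eq_square)
    also have "\<dots> = (\<beta> i)\<^sup>2 * adj E (\<pi> k) (\<pi> i)"
      by (rule sums_unique[OF sums_single, symmetric])
    finally have eq: "\<beta> k * (1 / of_nat (deg E i)) = (\<beta> i)\<^sup>2 * adj E (\<pi> k) (\<pi> i)" .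
    then have "adj E (\<pi> k) (\<pi> i) = (1 :: 'k)"
      using \<beta>_nonzero[of k] d by (auto simp: adj_def split: if_splits)
    then show "\<beta> k = of_nat (deg E i) * (\<beta> i)\<^sup>2" using eq d by (simp add: field_simps)
  qed

  \<comment> \<open>On an edge, \<open>\<gamma> i\<close> equals \<open>\<beta> k * \<beta> i\<close>, which is symmetric in the end points.\<close>
  define \<gamma> where "\<gamma> i = of_nat (deg E i) * \<beta> i ^ 3" for i
  have \<gamma>_edge: "\<gamma> i = \<beta> k * \<beta> i" if "E k i" for k i
    using edge(1)[OF that] by (simp add: \<gamma>_def eval_nat_numeral)
  have \<gamma>_adjacent: "\<gamma> k = \<gamma> i" if "E k i" for k i
    using \<gamma>_edge[OF that] \<gamma>_edge[OF sympD[OF sym that]] by (simp add: mult.commute)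
  have \<gamma>_const: "\<gamma> i = \<gamma> 0" for i
  proof -
    have "E\<^sup>*\<^sup>* i 0" using connected by (simp add: connected_graph_def)
    then show ?thesis by (induction rule: converse_rtranclp_induct) (simp_all add: \<gamma>_adjacent)
  qed
  have inv: "of_nat (deg E k * deg E i) * \<gamma> 0 = 1" if "E k i" for k i
  proof -
    have "\<gamma> 0 \<noteq> 0" using \<gamma>_edge[OF that] \<gamma>_const[of i] \<beta>_nonzero by simp
    have "(\<gamma> 0)\<^sup>2 = \<gamma> k * \<gamma> i" by (simp add: \<gamma>_const[of k] \<gamma>_const[of i] power2_eq_square)
    also have "\<dots> = of_nat (deg E k * deg E i) * (\<beta> k * \<beta> i) ^ 3"
      by (simp add: \<gamma>_def power_mult_distrib)
    also have "\<beta> k * \<beta> i = \<gamma> 0" using \<gamma>_edge[OF that] \<gamma>_const[of i] by simp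
    finally have "(of_nat (deg E k * deg E i) * \<gamma> 0) * (\<gamma> 0)\<^sup>2 = 1 * (\<gamma> 0)\<^sup>2"
      by (simp add: eval_nat_numeral mult.assoc)
    then show ?thesis using \<open>\<gamma> 0 \<noteq> 0\<close> by (metis mult_cancel_right power_eq_0_iff)
  qed
  have "deg E k * deg E i = deg E k' * deg E i'" if "E k i" "E k' i'" for k i k' i'
    using inv[OF that(1)] inv[OF that(2)]
    by (metis mult_cancel_right mult_zero_right of_nat_eq_iff zero_neq_one)
  then show ?thesis by metis
qed

end

end


section \<open>Degree products along the edges of a graph\<close>

text \<open>
  For the converse, the degrees \<open>p\<close> and \<open>q\<close> of the two ends of one edge are the only degrees, since
  a neighbour of a vertex of degree \<open>p\<close> has degree \<open>q\<close> and vice versa. If they differ, the degree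
  classes are the two parts.
\<close>
lemma regular_or_biregular_iff_degree_product_constant:
  assumes sym: "symp E" and connected: "connected_graph E" and pos: "\<And>i. deg E i > 0"
  shows "regular_graph E \<or> biregular_graph E
    \<longleftrightarrow> (\<exists>P. \<forall>k i. E k i \<longrightarrow> deg E k * deg E i = P)"
proof
  assume "regular_graph E \<or> biregular_graph E"
  then show "\<exists>P. \<forall>k i. E k i \<longrightarrow> deg E k * deg E i = P"
  proof
    assume "regular_graph E"
    then show ?thesis by (auto simp: regular_graph_def)
  next
    assume "biregular_graph E"
    then obtain V1 V2 d1 d2
      where "\<forall>i j. E i j \<longrightarrow> (i \<in> V1 \<and> j \<in> V2) \<or> (i \<in> V2 \<and> j \<in> V1)"
        and "\<forall>i\<in>V1. deg E i = d1" "\<forall>i\<in>V2. deg E i = d2"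
      unfolding biregular_graph_def by blast
    then have "\<forall>k i. E k i \<longrightarrow> deg E k * deg E i = d1 * d2"
      by (metis mult.commute)
    then show ?thesis by blast
  qed
next
  assume "\<exists>P. \<forall>k i. E k i \<longrightarrow> deg E k * deg E i = P"
  then obtain P where P: "\<And>k i. E k i \<Longrightarrow> deg E k * deg E i = P" by blast
  obtain j where "E j 0" using pos[of 0] by (fastforce simp: deg_def card_gt_0_iff)
  define p q where "p = deg E 0" and "q = deg E j"
  have pq: "deg E k * deg E i = p * q" if "E k i" for k i
    using P[OF that] P[OF \<open>E j 0\<close>] by (simp add: p_def q_def mult.commute)
  have swap: "deg E k = q" if "E k i" "deg E i = p" for k i
    using pq[OF that(1)] that(2) pos[of 0] by (simp add: p_def)
  have swap': "deg E k = p" if "E k i" "deg E i = q" for k i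
    using pq[OF that(1)] that(2) pos[of j] by (simp add: q_def)
  have cases: "deg E i = p \<or> deg E i = q" for i
  proof -
    have "E\<^sup>*\<^sup>* i 0" using connected by (simp add: connected_graph_def)
    then show ?thesis
      by (induction rule: converse_rtranclp_induct) (use swap swap' p_def in blast)+
  qed
  show "regular_graph E \<or> biregular_graph E"
  proof (cases "p = q")
    case True
    then show ?thesis using cases by (auto simp: regular_graph_def)
  next
    case False
    have "biregular_graph E"
      unfolding biregular_graph_def
    proof (intro exI conjI)
      show "{i. deg E i = p} \<union> {i. deg E i = q} = UNIV" using cases by blast
      show "{i. deg E i = p} \<inter> {i. deg E i = q} = {}" using False by blast
      show "\<forall>i k. E i k \<longrightarrow> i \<in> {i. deg E i = p} \<and> k \<in> {i. deg E i = q} \<or>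
          i \<in> {i. deg E i = q} \<and> k \<in> {i. deg E i = p}"
        using cases swap swap' by blast
      show "\<forall>i\<in>{i. deg E i = p}. deg E i = p" by simp
      show "\<forall>i\<in>{i. deg E i = q}. deg E i = q" by simp
    qed
    then show ?thesis ..
  qed
qed

lemma connected_graph_deg_pos:
  assumes "symp E" "connected_graph E" "bounded_degree E"
  shows "deg E i > 0"
proof -
  have "E\<^sup>*\<^sup>* i (Suc i)" using assms(2) by (simp add: connected_graph_def)
  then obtain k where "E i k" by (metis converse_rtranclpE n_not_Suc_n)
  then have "E k i" using assms(1) by (simp add: sympD)
  then show ?thesis using assms(3) by (auto simp: deg_def bounded_degree_def card_gt_0_iff)
qed

theorem theorem3p3:
  fixes scl :: "'k::rc_field \<Rightarrow> 'a::banach \<Rightarrow> 'a"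
    and ip :: "'a \<Rightarrow> 'a \<Rightarrow> 'k"
    and e :: "nat \<Rightarrow> 'a"
    and E :: "nat \<Rightarrow> nat \<Rightarrow> bool"
  assumes "hilbert_space scl ip"
    and "orthonormal_basis scl ip e"
    and "simple_graph E"
    and "connected_graph E"
    and "bounded_degree E"
  shows "(regular_graph E \<or> biregular_graph E \<longrightarrow>
            hea_isomorphic scl ip (random_walk_product scl ip e E)
                           scl ip (graph_product scl ip e E)) \<and>
         (nonsingular_graph TYPE('k) E \<and>
          hea_isomorphic scl ip (random_walk_product scl ip e E)
                         scl ip (graph_product scl ip e E) \<longrightarrow>
            regular_graph E \<or> biregular_graph E)"
proof -
  interpret based_hilbert_space scl ip e
    using assms(1,2) by (simp add: based_hilbert_space_def based_hilbert_space_axioms_def)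
  have sym: "symp E" using assms(3) by (simp add: simple_graph_def)
  have pos: "deg E i > 0" for i by (rule connected_graph_deg_pos[OF sym assms(4,5)])
  note constant_iff = regular_or_biregular_iff_degree_product_constant[OF sym assms(4) pos]
  show ?thesis
  proof (intro conjI impI)
    assume "regular_graph E \<or> biregular_graph E"
    then obtain P where P: "\<And>k i. E k i \<Longrightarrow> deg E k * deg E i = P"
      using constant_iff by blast
    obtain k where "E k 0" using pos[of 0] by (fastforce simp: deg_def card_gt_0_iff)
    then have "P > 0" using P pos by (metis nat_0_less_mult_iff)
    then show "hea_isomorphic scl ip (random_walk_product scl ip e E)
        scl ip (graph_product scl ip e E)"
      by (rule isomorphic_if_degree_product_constant[OF assms(5) pos _ P])
  next
    assume "nonsingular_graph TYPE('k) E \<and>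
      hea_isomorphic scl ip (random_walk_product scl ip e E) scl ip (graph_product scl ip e E)"
    then show "regular_graph E \<or> biregular_graph E"
      using degree_product_constant_if_isomorphic[OF assms(5,4) sym] constant_iff by blast
  qed
qed

end
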